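(* Let $\mathcal{H},\mathcal{J}\in\mathfrak{Q}$ be interval queues, $\mathsf{G}$ a finite set of atomic propositions, $I\in\mathbb{I}_{\mathbb{Q}}$ nondegenerate, $\varphi_1,\varphi_2\in\mathfrak{F}(\mathsf{G})$, and $z:[0,\infty)\to2^{\mathsf{G}}$ a signal of finite variability, and suppose $T_z(\varphi_1)\supseteq\bigcup\mathcal{H}$ and $T_z(\varphi_2)\supseteq\bigcup\mathcal{J}$. Then $\mathcal{H}\boxdot_I\mathcal{J}\in\mathfrak{Q}$. Moreover, if $T_z(\varphi_1)=\bigcup\mathcal{H}$ and $T_z(\varphi_2)=\bigcup\mathcal{J}$, then $T_z(\varphi_1\,\mathcal{U}_I\,\varphi_2)=\bigcup(\mathcal{H}\boxdot_I\mathcal{J})$. Finally, if $\mathcal{H}\subseteq\mathbb{I}_{\mathbb{Q}}$ and $\mathcal{J}\subseteq\mathbb{I}_{\mathbb{Q}}$, then $\mathcal{H}\boxdot_I\mathcal{J}\subseteq\mathbb{I}_{\mathbb{Q}}$.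
   Context: Intervals. An interval is a connected subset of $\mathbb{R}$; it is degenerate if it has at most one point, and nondegenerate otherwise. $\mathbb{I}$ is the set of intervals contained in $[0,\infty)$ (including $\emptyset$). $\mathbb{I}_{\mathbb{Q}}:=\{I\in\mathbb{I}\setminus\{\emptyset\}\mid \sup I,\inf I\in\mathbb{Q}\cup\{\infty\}\}$. $\mathrm{cl}$ denotes closure in $\mathbb{R}$. For a set of sets $\mathcal{A}$, $\bigcup\mathcal{A}:=\bigcup_{B\in\mathcal{A}}B$. Sets $A,B$ are separated iff $A\cap\mathrm{cl}(B)=B\cap\mathrm{cl}(A)=\emptyset$. Interval queues. An interval queue is a finite set $\mathcal{I}\subseteq\mathbb{I}\setminus\{\emptyset\}$ such that any two distinct elements are separated. $\mathfrak{Q}$ is the set of interval queues (note $\emptyset\in\mathfrak{Q}$). MITL. Formulas over $\mathsf{G}$ are generated by $\varphi::=\top\mid\mathsf{g}\mid\lnot\varphi\mid\varphi\land\varphi\mid\varphi\,\mathcal{U}_I\,\varphi$, with $\mathsf{g}\in\mathsf{G}$ and $I\in\mathbb{I}_{\mathbb{Q}}$ nondegenerate; $\mathfrak{F}(\mathsf{G})$ is the set of formulas. A signal $z:[0,\infty)\to2^{\mathsf{G}}$ has finite variability if there is a sequence of nonempty intervals partitioning $[0,\infty)$, consecutive ones adjacent (in increasing order), with $z$ constant on each. Semantics, for $t\ge0$: $(z,t)\models\top$ always; $(z,t)\models\mathsf{g}$ iff $\mathsf{g}\in z(t)$; $(z,t)\models\lnot\varphi_1$ iff $(z,t)\not\models\varphi_1$;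 $(z,t)\models\varphi_1\land\varphi_2$ iff $(z,t)\models\varphi_1$ and $(z,t)\models\varphi_2$; $(z,t)\models\varphi_1\,\mathcal{U}_I\,\varphi_2$ iff there is $t_2\in I$ with $(z,t+t_2)\models\varphi_2$ and $(z,t+t_1)\models\varphi_1$ for all $t_1\in(0,t_2)$. The truth set is $T_z(\varphi):=\{t\in[0,\infty)\mid(z,t)\models\varphi\}$. ConstructIQ. For a finite set $\{I_1,\dots,I_m\}\subseteq\mathbb{I}$, $\mathtt{ConstructIQ}(\{I_1,\dots,I_m\})$ is computed as follows. Start with $\mathcal{J}:=\emptyset$. For $i=1,\dots,m$: let $\mathcal{W}:=\{J\in\mathcal{J}\mid I_i\cup J\in\mathbb{I}\}\cup\{I_i\}$ and replace $\mathcal{J}$ by $(\mathcal{J}\setminus\mathcal{W})\cup\{\bigcup\mathcal{W}\}$. Return $\mathcal{J}\setminus\{\emptyset\}$. Until operation. For $\mathcal{H},\mathcal{J}\in\mathfrak{Q}$ and $I\in\mathbb{I}$, $\mathcal{H}\boxdot_I\mathcal{J}:=\mathtt{ConstructIQ}(\mathcal{Y})$ with $\mathcal{Y}:=\{((\mathrm{cl}(H)\cap J)\ominus I)\cap\mathrm{cl}(H)\mid H\in\mathcal{H},J\in\mathcal{J}\}$, where $B\ominus A:=\{b-a\mid b\in B,a\in A\}$.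
   Formalization: The truth-set equality is claimed, when 0 ∈ I, only if ⋃𝒥 ⊆ cl(⋃ℋ), since otherwise it is false; and ConstructIQ processes the empty set first if it occurs, since processing it later can merge separated intervals. *)

theory Defs
  imports "HOL-Analysis.Analysis"
begin

section \<open>Intervals and interval queues\<close>

definition nonneg_intervals :: "real set set" where
  "nonneg_intervals = {S. connected S \<and> S \<subseteq> {0..}}"

definition nondegenerate :: "real set \<Rightarrow> bool" where
  "nondegenerate S \<longleftrightarrow> \<not> (\<exists>x. S \<subseteq> {x})"

text \<open>Suprema and infima are taken in \<^typ>\<open>ereal\<close>, so that an unbounded interval has supremum \<open>\<infinity>\<close>.\<close>

definition rat_intervals :: "real set set" where
  "rat_intervals = {S \<in> nonneg_intervals - {{}}.
     Sup (ereal ` S) \<in> insert \<infinity> (ereal ` \<rat>) \<and> Inf (ereal ` S) \<in> insert \<infinity> (ereal ` \<rat>)}"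

definition interval_queues :: "real set set set" where
  "interval_queues = {Q. finite Q \<and> Q \<subseteq> nonneg_intervals - {{}} \<and>
     pairwise (separatedin euclidean) Q}"


section \<open>Metric interval temporal logic\<close>

datatype 'g mitl =
    Top
  | Atom 'g
  | Neg "'g mitl"
  | Conj "'g mitl" "'g mitl"
  | Until "'g mitl" "real set" "'g mitl"

inductive_set mitl_formulas :: "'g set \<Rightarrow> 'g mitl set" for G :: "'g set" where
  Top: "Top \<in> mitl_formulas G"
| Atom: "g \<in> G \<Longrightarrow> Atom g \<in> mitl_formulas G"
| Neg: "\<phi> \<in> mitl_formulas G \<Longrightarrow> Neg \<phi> \<in> mitl_formulas G"
| Conj: "\<phi> \<in> mitl_formulas G \<Longrightarrow> \<psi> \<in> mitl_formulas G \<Longrightarrow> Conj \<phi> \<psi> \<in> mitl_formulas G"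
| Until: "\<phi> \<in> mitl_formulas G \<Longrightarrow> \<psi> \<in> mitl_formulas G \<Longrightarrow> I \<in> rat_intervals \<Longrightarrow>
    nondegenerate I \<Longrightarrow> Until \<phi> I \<psi> \<in> mitl_formulas G"

text \<open>A signal is a function on \<open>[0,\<infinity>)\<close>; its values at negative times are irrelevant throughout.\<close>

definition signal :: "'g set \<Rightarrow> (real \<Rightarrow> 'g set) \<Rightarrow> bool" where
  "signal G z \<longleftrightarrow> (\<forall>t\<ge>0. z t \<subseteq> G)"

text \<open>The sequence is infinite. Finite sequences give the same notion: the last interval
  of a finite partition of \<open>[0,\<infinity>)\<close> is unbounded and can be cut into infinitely many pieces.\<close>

definition finite_variability :: "(real \<Rightarrow> 'g set) \<Rightarrow> bool" where
  "finite_variability z \<longleftrightarrow>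
    (\<exists>S :: nat \<Rightarrow> real set.
       (\<forall>n. S n \<in> nonneg_intervals - {{}}) \<and>
       disjoint_family S \<and> (\<Union>n. S n) = {0..} \<and>
       (\<forall>n. S n \<union> S (Suc n) \<in> nonneg_intervals \<and> (\<forall>x \<in> S n. \<forall>y \<in> S (Suc n). x < y)) \<and>
       (\<forall>n. z constant_on S n))"

primrec sat :: "(real \<Rightarrow> 'g set) \<Rightarrow> real \<Rightarrow> 'g mitl \<Rightarrow> bool" where
  "sat z t Top \<longleftrightarrow> True"
| "sat z t (Atom g) \<longleftrightarrow> g \<in> z t"
| "sat z t (Neg \<phi>) \<longleftrightarrow> \<not> sat z t \<phi>"
| "sat z t (Conj \<phi> \<psi>) \<longleftrightarrow> sat z t \<phi> \<and> sat z t \<psi>"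
| "sat z t (Until \<phi> I \<psi>) \<longleftrightarrow>
     (\<exists>t2 \<in> I. sat z (t + t2) \<psi> \<and> (\<forall>t1 \<in> {0<..<t2}. sat z (t + t1) \<phi>))"

definition truth_set :: "(real \<Rightarrow> 'g set) \<Rightarrow> 'g mitl \<Rightarrow> real set" where
  "truth_set z \<phi> = {t. 0 \<le> t \<and> sat z t \<phi>}"


section \<open>Construction of interval queues\<close>

definition absorb :: "real set \<Rightarrow> real set set \<Rightarrow> real set set" where
  "absorb I \<J> = (let \<W> = {J \<in> \<J>. I \<union> J \<in> nonneg_intervals} \<union> {I} in (\<J> - \<W>) \<union> {\<Union>\<W>})"

definition construct_iq_list :: "real set list \<Rightarrow> real set set" where
  "construct_iq_list Is = fold absorb Is {} - {{}}"

text \<open>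
  The algorithm enumerates its finite input set in an arbitrary order, except that the empty set,
  if present, has to be processed first. Since \<open>{} \<union> J\<close> is an interval for every interval \<open>J\<close>,
  processing it later would merge all sets collected so far, whether or not they touch:
\<close>

lemma construct_iq_list_empty_last: "construct_iq_list [{0}, {1}, {}] = {{0, 1}}"
proof -
  have nc: "{1, 0} \<notin> nonneg_intervals"
    using connected_finite_iff_sing[of "{1, 0::real}"] by (auto simp: nonneg_intervals_def)
  have sing: "{x} \<in> nonneg_intervals" if "0 \<le> x" for x
    using that by (simp add: nonneg_intervals_def)
  have "absorb {0} {} = {{0}}"
    by (simp add: absorb_def)
  moreover have "absorb {1} {{0}} = {{0}, {1}}"
  proof -
    have "{J \<in> {{0}}. {1} \<union> J \<in> nonneg_intervals} = {}"
      using nc by auto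
    then show ?thesis
      unfolding absorb_def Let_def by auto
  qed
  moreover have "absorb {} {{0}, {1}} = {{0, 1}}"
  proof -
    have "{J \<in> {{0}, {1}}. {} \<union> J \<in> nonneg_intervals} = {{0}, {1}}"
      using sing by auto
    then show ?thesis
      unfolding absorb_def Let_def by auto
  qed
  ultimately show ?thesis
    by (simp add: construct_iq_list_def)
qed

definition enumerates :: "real set list \<Rightarrow> real set set \<Rightarrow> bool" where
  "enumerates Is \<Y> \<longleftrightarrow> set Is = \<Y> \<and> distinct Is \<and> {} \<notin> set (tl Is)"

definition construct_iq :: "real set set \<Rightarrow> real set set" where
  "construct_iq \<Y> = construct_iq_list (SOME Is. enumerates Is \<Y>)"

text \<open>Up to that convention the choice of the enumeration is immaterial, as \<open>construct_iq_eq\<close>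
  below shows.\<close>

lemma absorb_correct:
  assumes I: "I \<in> nonneg_intervals" "I \<noteq> {}"
    and J: "finite \<J>" "\<J> \<subseteq> nonneg_intervals" "pairwise (separatedin euclidean) \<J>"
  shows "finite (absorb I \<J>)" "absorb I \<J> \<subseteq> nonneg_intervals"
    "pairwise (separatedin euclidean) (absorb I \<J>)" "\<Union>(absorb I \<J>) = I \<union> \<Union>\<J>"
proof -
  define \<W> where "\<W> = {J \<in> \<J>. I \<union> J \<in> nonneg_intervals} \<union> {I}"
  have ab: "absorb I \<J> = (\<J> - \<W>) \<union> {\<Union>\<W>}"
    by (simp add: absorb_def \<W>_def Let_def)
  have finW: "finite \<W>"
    using J by (simp add: \<W>_def)
  show "finite (absorb I \<J>)"
    using J by (simp add: ab)
  show "\<Union>(absorb I \<J>) = I \<union> \<Union>\<J>"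
    by (auto simp: ab \<W>_def)
  have UW: "\<Union>\<W> = (\<Union>J\<in>\<W>. I \<union> J)"
    by (auto simp: \<W>_def)
  have "connected (\<Union>J\<in>\<W>. I \<union> J)"
    using I by (intro connected_Union) (auto simp: \<W>_def nonneg_intervals_def)
  moreover have "\<Union>\<W> \<subseteq> {0..}"
    using I J by (auto simp: \<W>_def nonneg_intervals_def)
  ultimately have W: "\<Union>\<W> \<in> nonneg_intervals"
    by (simp add: UW nonneg_intervals_def)
  then show "absorb I \<J> \<subseteq> nonneg_intervals"
    using J by (auto simp: ab)
  have sep: "separatedin euclidean K (\<Union>\<W>)" if K: "K \<in> \<J> - \<W>" for K
  proof -
    have "separatedin euclidean K T" if T: "T \<in> \<W>" for T
    proof (cases "T = I")
      case True
      have "connected I" "connected K" "I \<subseteq> {0..}" "K \<subseteq> {0..}"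
        using I J K by (auto simp: nonneg_intervals_def)
      then show ?thesis
        using K connectedin_nonseparated_union[of euclidean I K] True
        by (auto simp: \<W>_def nonneg_intervals_def separatedin_sym)
    next
      case False
      then have "T \<in> \<J>" "T \<noteq> K"
        using T K by (auto simp: \<W>_def)
      then show ?thesis
        using K J(3) by (auto simp: pairwise_def)
    qed
    then show ?thesis
      using finW by (simp add: separatedin_Union)
  qed
  show "pairwise (separatedin euclidean) (absorb I \<J>)"
    using J(3) sep unfolding ab pairwise_def by (auto simp: separatedin_sym)
qed

lemma fold_absorb_correct:
  assumes "set Is \<subseteq> nonneg_intervals - {{}}"
    and "finite \<J>" "\<J> \<subseteq> nonneg_intervals" "pairwise (separatedin euclidean) \<J>"
  shows "finite (fold absorb Is \<J>) \<and> fold absorb Is \<J> \<subseteq> nonneg_intervals \<and>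
    pairwise (separatedin euclidean) (fold absorb Is \<J>) \<and>
    \<Union>(fold absorb Is \<J>) = \<Union>(set Is) \<union> \<Union>\<J>"
  using assms
proof (induction Is arbitrary: \<J>)
  case (Cons I Is)
  have I: "I \<in> nonneg_intervals" "I \<noteq> {}"
    using Cons.prems by auto
  note c = absorb_correct[OF I Cons.prems(2-4)]
  show ?case
    using Cons.IH[OF _ c(1-3)] Cons.prems(1) by (auto simp: c(4))
qed simp

lemma construct_iq_list_correct:
  assumes "set Is \<subseteq> nonneg_intervals" "{} \<notin> set (tl Is)"
  shows "construct_iq_list Is \<in> interval_queues" "\<Union>(construct_iq_list Is) = \<Union>(set Is)"
proof -
  have *: "finite (fold absorb Is {}) \<and> fold absorb Is {} \<subseteq> nonneg_intervals \<and>
    pairwise (separatedin euclidean) (fold absorb Is {}) \<and> \<Union>(fold absorb Is {}) = \<Union>(set Is)"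
  proof (cases Is)
    case (Cons I Js)
    have "absorb I {} = {I}"
      by (simp add: absorb_def)
    then show ?thesis
      using assms fold_absorb_correct[of Js "{I}"] Cons by auto
  qed simp
  then show "construct_iq_list Is \<in> interval_queues"
    by (auto simp: construct_iq_list_def interval_queues_def pairwise_def)
  show "\<Union>(construct_iq_list Is) = \<Union>(set Is)"
    using * by (auto simp: construct_iq_list_def)
qed

lemma connected_subset_interval_queue:
  assumes Q: "Q \<in> interval_queues" and C: "connected C" "C \<noteq> {}" "C \<subseteq> \<Union>Q"
  obtains K where "K \<in> Q" "C \<subseteq> K"
proof -
  obtain x K where x: "x \<in> C" "x \<in> K" "K \<in> Q"
    using C by blast
  have fin: "finite (Q - {K})"
    using Q by (simp add: interval_queues_def)
  have "separatedin euclidean K (\<Union>(Q - {K}))"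
    using Q x(3) fin by (auto simp: separatedin_Union interval_queues_def pairwise_def)
  moreover have "C \<subseteq> K \<union> \<Union>(Q - {K})"
    using C(3) by blast
  ultimately have "C \<subseteq> K \<or> C \<subseteq> \<Union>(Q - {K})"
    using C(1) connectedin_subset_separated_union by (metis connectedin_iff_connected)
  moreover have "K \<inter> \<Union>(Q - {K}) = {}"
    using \<open>separatedin euclidean K (\<Union>(Q - {K}))\<close> separatedin_imp_disjoint
    by (metis disjnt_def)
  ultimately show ?thesis
    using x that by blast
qed

lemma interval_queue_unique:
  assumes "P \<in> interval_queues" "Q \<in> interval_queues" "\<Union>P = \<Union>Q"
  shows "P = Q"
proof -
  have "P \<subseteq> Q"
    if P: "P \<in> interval_queues" and Q: "Q \<in> interval_queues" and eq: "\<Union>P = \<Union>Q" for P Q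
  proof
    fix K assume K: "K \<in> P"
    then have "connected K" "K \<noteq> {}" "K \<subseteq> \<Union>Q"
      using P eq by (auto simp: interval_queues_def nonneg_intervals_def)
    then obtain L where L: "L \<in> Q" "K \<subseteq> L"
      using connected_subset_interval_queue[OF Q] by metis
    then have "connected L" "L \<noteq> {}" "L \<subseteq> \<Union>P"
      using Q eq by (auto simp: interval_queues_def nonneg_intervals_def)
    then obtain M where M: "M \<in> P" "L \<subseteq> M"
      using connected_subset_interval_queue[OF P] by metis
    have "\<not> disjnt K M"
      using \<open>K \<noteq> {}\<close> L M by (auto simp: disjnt_def)
    then have "K = M"
      using K M(1) P separatedin_imp_disjoint
      by (fastforce simp: interval_queues_def pairwise_def)
    then show "K \<in> Q"
      using L M by auto
  qed
  then show ?thesis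
    using assms by (metis subset_antisym)
qed

lemma ex_enumerates:
  assumes "finite \<Y>"
  shows "\<exists>Is. enumerates Is \<Y>"
proof -
  obtain Js where Js: "set Js = \<Y> - {{}}" "distinct Js"
    using finite_distinct_list[of "\<Y> - {{}}"] assms by auto
  have "enumerates (if {} \<in> \<Y> then {} # Js else Js) \<Y>"
    using Js by (cases Js) (auto simp: enumerates_def)
  then show ?thesis ..
qed

lemma construct_iq_eq:
  assumes "\<Y> \<subseteq> nonneg_intervals" "enumerates Is \<Y>"
  shows "construct_iq \<Y> = construct_iq_list Is"
proof -
  have "enumerates (SOME Js. enumerates Js \<Y>) \<Y>"
    using assms(2) by (rule someI)
  then have *: "set (SOME Js. enumerates Js \<Y>) = \<Y>" "{} \<notin> set (tl (SOME Js. enumerates Js \<Y>))"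
    by (simp_all add: enumerates_def)
  have **: "set Is = \<Y>" "{} \<notin> set (tl Is)"
    using assms(2) by (simp_all add: enumerates_def)
  show ?thesis
    unfolding construct_iq_def
    using * ** assms(1) by (intro interval_queue_unique) (simp_all add: construct_iq_list_correct)
qed


section \<open>The until operation\<close>

definition set_diffs :: "real set \<Rightarrow> real set \<Rightarrow> real set" (infixl "\<ominus>" 65) where
  "B \<ominus> A = {b - a | b a. b \<in> B \<and> a \<in> A}"

definition until_pieces :: "real set set \<Rightarrow> real set \<Rightarrow> real set set \<Rightarrow> real set set" where
  "until_pieces \<H> I \<J> =
     {((closure H \<inter> J) \<ominus> I) \<inter> closure H | H J. H \<in> \<H> \<and> J \<in> \<J>}"

definition until_iq :: "real set set \<Rightarrow> real set \<Rightarrow> real set set \<Rightarrow> real set set" where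
  "until_iq \<H> I \<J> = construct_iq (until_pieces \<H> I \<J>)"

text \<open>
  If \<open>0 \<in> I\<close>, then \<open>\<phi> U\<^sub>I \<psi>\<close> holds wherever \<open>\<psi>\<close> does, because the requirement on \<open>\<phi>\<close> over the
  empty interval \<open>(0,0)\<close> is void. The until operation only yields times in the closure of \<open>\<Union>\<H>\<close>,
  so it computes the truth set of \<open>\<phi> U\<^sub>I \<psi>\<close> only if, in this case, \<open>\<Union>\<J>\<close> lies in that closure.
  Without this proviso it fails already for \<open>\<H> = {}\<close> and \<open>\<J> = {[0,1]}\<close>:
\<close>

lemma until_iq_zero_proviso_needed:
  fixes g :: 'g
  defines "z \<equiv> \<lambda>t::real. if t \<in> {0..1} then {g} else {}"
  shows "{} \<in> interval_queues" "{{0..1}} \<in> interval_queues"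
    "{0..1} \<in> rat_intervals" "nondegenerate {0..1}"
    "Neg Top \<in> mitl_formulas {g}" "Atom g \<in> mitl_formulas {g}"
    "signal {g} z" "finite_variability z"
    "truth_set z (Neg Top) = \<Union>{}" "truth_set z (Atom g) = \<Union>{{0..1}}"
    "truth_set z (Until (Neg Top) {0..1} (Atom g)) \<noteq> \<Union>(until_iq {} {0..1} {{0..1}})"
proof -
  show "{} \<in> interval_queues" "{{0..1}} \<in> interval_queues"
    by (auto simp: interval_queues_def nonneg_intervals_def)
  show "{0..1} \<in> rat_intervals"
  proof -
    have "Sup (ereal ` {0..1}) = ereal 1" "Inf (ereal ` {0..1}) = ereal 0"
      by (auto intro!: Sup_eqI Inf_eqI)
    moreover have "ereal 1 \<in> ereal ` \<rat>" "ereal 0 \<in> ereal ` \<rat>"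
      using Rats_0 Rats_1 by blast+
    ultimately show ?thesis
      by (auto simp: rat_intervals_def nonneg_intervals_def)
  qed
  show "nondegenerate {0..1}"
    unfolding nondegenerate_def
    by (metis atLeastAtMost_iff order.refl singletonD subsetD zero_le_one zero_neq_one)
  show "Neg Top \<in> mitl_formulas {g}" "Atom g \<in> mitl_formulas {g}"
    by (auto intro: mitl_formulas.intros)
  show "signal {g} z"
    by (auto simp: signal_def z_def)
  show "finite_variability z"
  proof -
    define S where "S n = (if n = 0 then {0..1} else {real n<..real n + 1})" for n
    have cover: "(\<Union>n. S n) = {0..}"
    proof
      show "{0..} \<subseteq> (\<Union>n. S n)"
      proof
        fix x :: real assume x: "x \<in> {0..}"
        have "x \<in> S (nat (\<lceil>x\<rceil> - 1))"
        proof (cases "x \<le> 1")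
          case True
          then show ?thesis
            using x by (auto simp: S_def ceiling_le_iff)
        next
          case False
          then show ?thesis
            by (auto simp: S_def) linarith+
        qed
        then show "x \<in> (\<Union>n. S n)"
          by blast
      qed
    qed (auto simp: S_def split: if_splits)
    have step: "S n \<union> S (Suc n) = (if n = 0 then {0..2} else {real n<..real n + 2})" for n
      by (auto simp: S_def)
    have "S n \<in> nonneg_intervals - {{}}" for n
      by (auto simp: S_def nonneg_intervals_def)
    moreover have "disjoint_family S"
      unfolding disjoint_family_on_def
    proof (intro ballI impI)
      fix m n :: nat
      assume "m \<noteq> n"
      then have "real m + 1 \<le> real n \<or> real n + 1 \<le> real m"
        by linarith
      then show "S m \<inter> S n = {}"
        by (auto simp: S_def)
    qed
    moreover have "S n \<union> S (Suc n) \<in> nonneg_intervals" for n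
      unfolding step by (auto simp: nonneg_intervals_def)
    moreover have "\<forall>x \<in> S n. \<forall>y \<in> S (Suc n). x < y" for n
      by (auto simp: S_def)
    moreover have "z constant_on S n" for n
      by (auto simp: S_def constant_on_def z_def)
    ultimately show ?thesis
      unfolding finite_variability_def using cover by blast
  qed
  show "truth_set z (Neg Top) = \<Union>{}" "truth_set z (Atom g) = \<Union>{{0..1}}"
    by (auto simp: truth_set_def z_def)
  have "enumerates [] (until_pieces {} {0..1} {{0..1}})"
    by (simp add: until_pieces_def enumerates_def)
  then have "until_iq {} {0..1} {{0..1}} = {}"
    unfolding until_iq_def
    by (subst construct_iq_eq) (auto simp: until_pieces_def construct_iq_list_def)
  moreover have "0 \<in> truth_set z (Until (Neg Top) {0..1} (Atom g))"
    by (auto simp: truth_set_def z_def intro!: bexI[of _ 0])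
  ultimately show "truth_set z (Until (Neg Top) {0..1} (Atom g)) \<noteq> \<Union>(until_iq {} {0..1} {{0..1}})"
    by auto
qed

end

theory Submission
  imports Defs
begin

text \<open>
  If \<open>\<phi>\<^sub>1\<close> holds throughout the nonempty open interval \<open>(t, t + t\<^sub>2)\<close>, connectedness puts this
  interval into a single \<open>H \<in> \<H>\<close>, so \<open>t\<close> and \<open>t + t\<^sub>2\<close> lie in \<open>cl H\<close>; conversely an open interval
  with both endpoints in \<open>cl H\<close> is contained in \<open>H\<close>. Rationality of the endpoints of a nonempty
  interval means that its frontier lies in \<open>\<rat>\<close>, a condition that passes to closures,
  intersections, finite unions and, for convex sets, differences \<open>\<ominus>\<close>.
\<close>

section \<open>Frontiers of real convex sets and rational endpoints\<close>

text \<open>For convex sets on the line, being interior is the same as lying strictly between two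
  members. A frontier point is thus a closure point that bounds the set on one side, an order
  condition that suits suprema and infima.\<close>

lemma convex_frontier_real_iff:
  fixes S :: "real set"
  assumes "convex S"
  shows "x \<in> frontier S \<longleftrightarrow> x \<in> closure S \<and> ((\<forall>y\<in>S. y \<le> x) \<or> (\<forall>y\<in>S. x \<le> y))"
proof -
  have "x \<in> interior S" if "y \<in> S" "z \<in> S" "y < x" "x < z" for y z
  proof -
    have "w \<in> S" if "w \<in> {y<..<z}" for w
      using mem_is_interval_1_I[of S y z w] assms \<open>y \<in> S\<close> \<open>z \<in> S\<close> that
      by (simp add: is_interval_convex_1)
    then have "{y<..<z} \<subseteq> S"
      by blast
    then show ?thesis
      using interiorI[of "{y<..<z}" x S] that by simp
  qed
  moreover have "\<exists>y\<in>S. \<exists>z\<in>S. y < x \<and> x < z" if int: "x \<in> interior S"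
  proof -
    \<comment> \<open>A closed ball is taken so that its endpoints \<open>x - e\<close> and
      \<open>x + e\<close> belong to \<open>S\<close> and serve as the two witnesses.\<close>
    obtain e where e: "e > 0" "cball x e \<subseteq> S"
      using int mem_interior_cball by blast
    have "x - e \<in> S" "x + e \<in> S"
      using e(1) by (auto intro!: subsetD[OF e(2)] simp: dist_real_def)
    then show ?thesis
      using e(1) by (metis add.commute diff_add_cancel less_add_same_cancel1)
  qed
  ultimately have "x \<in> interior S \<longleftrightarrow> (\<exists>y\<in>S. \<exists>z\<in>S. y < x \<and> x < z)"
    by blast
  then show ?thesis
    unfolding frontier_def Diff_iff by (auto simp flip: not_less)
qed

text \<open>Translates the extended-real supremum from \<open>rat_intervals\<close> into the
  closure-and-bound form in which frontier points are described.\<close>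

lemma Sup_ereal_image_eq_iff:
  assumes "S \<noteq> {}"
  shows "Sup (ereal ` S) = ereal x \<longleftrightarrow> x \<in> closure S \<and> (\<forall>y\<in>S. y \<le> x)"
proof
  assume *: "Sup (ereal ` S) = ereal x"
  have ub: "\<forall>y\<in>S. y \<le> x"
    using * by (metis SUP_upper ereal_less_eq(3))
  moreover have "\<exists>y\<in>S. dist y x < e" if "e > 0" for e
  proof -
    have "ereal (x - e) < Sup (ereal ` S)"
      using * that by simp
    then obtain y where "y \<in> S" "x - e < y"
      by (auto simp: less_Sup_iff)
    then show ?thesis
      using ub by (intro bexI[of _ y]) (auto simp: dist_real_def)
  qed
  ultimately show "x \<in> closure S \<and> (\<forall>y\<in>S. y \<le> x)"
    by (auto simp: closure_approachable)
next
  assume *: "x \<in> closure S \<and> (\<forall>y\<in>S. y \<le> x)"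
  show "Sup (ereal ` S) = ereal x"
  proof (rule antisym)
    show "Sup (ereal ` S) \<le> ereal x"
      using * by (auto intro!: SUP_least)
    show "ereal x \<le> Sup (ereal ` S)"
    proof (rule ereal_le_epsilon2)
      fix e :: real assume "e > 0"
      then obtain y where y: "y \<in> S" "dist y x < e"
        using * by (meson closure_approachable)
      then have "ereal x \<le> ereal y + ereal e"
        by (auto simp: dist_real_def)
      also have "\<dots> \<le> Sup (ereal ` S) + ereal e"
        using y(1) by (intro add_right_mono) (auto intro: SUP_upper)
      finally show "ereal x \<le> Sup (ereal ` S) + ereal e" .
    qed
  qed
qed

lemma Inf_ereal_image_eq_iff:
  assumes "S \<noteq> {}"
  shows "Inf (ereal ` S) = ereal x \<longleftrightarrow> x \<in> closure S \<and> (\<forall>y\<in>S. x \<le> y)"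
proof -
  \<comment> \<open>Reflection at 0 reduces the infimum to the supremum case.\<close>
  have "Sup (ereal ` uminus ` S) = - Inf (ereal ` S)"
    using ereal_Sup_uminus_image_eq[of "ereal ` S"] by (simp add: image_image)
  then have "Inf (ereal ` S) = ereal x \<longleftrightarrow> Sup (ereal ` uminus ` S) = ereal (- x)"
    using ereal_uminus_eq_reorder by auto
  also have "\<dots> \<longleftrightarrow> x \<in> closure S \<and> (\<forall>y\<in>S. x \<le> y)"
    using assms closure_injective_linear_image[of "uminus :: real \<Rightarrow> real" S, symmetric]
    by (auto simp: Sup_ereal_image_eq_iff linear_iff)
  finally show ?thesis .
qed

text \<open>The frontier consists exactly of the finite values among supremum and infimum. For a
  nonempty subset of the half-line the infimum is always finite, so only the supremum can take the
  permitted value \<infinity>.\<close>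

lemma rat_intervals_iff_frontier:
  "S \<in> rat_intervals \<longleftrightarrow> S \<in> nonneg_intervals \<and> S \<noteq> {} \<and> frontier S \<subseteq> \<rat>"
proof (cases "S \<in> nonneg_intervals \<and> S \<noteq> {}")
  case True
  then have cvx: "convex S" and ne: "S \<noteq> {}" and pos: "S \<subseteq> {0..}"
    by (auto simp: nonneg_intervals_def is_interval_connected_1[symmetric] is_interval_convex_1)
  obtain s where s: "s \<in> S"
    using ne by blast
  have "ereal s \<le> Sup (ereal ` S)"
    using s by (auto intro: SUP_upper)
  then have sup: "Sup (ereal ` S) = \<infinity> \<or> (\<exists>x. Sup (ereal ` S) = ereal x)"
    by (cases "Sup (ereal ` S)") auto
  have "ereal 0 \<le> Inf (ereal ` S)" "Inf (ereal ` S) \<le> ereal s"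
    using s pos by (auto intro!: INF_greatest INF_lower)
  then obtain i where inf: "Inf (ereal ` S) = ereal i"
    by (cases "Inf (ereal ` S)") auto
  have "frontier S = {x. Sup (ereal ` S) = ereal x \<or> Inf (ereal ` S) = ereal x}"
    using convex_frontier_real_iff[OF cvx] Sup_ereal_image_eq_iff[OF ne]
      Inf_ereal_image_eq_iff[OF ne] by blast
  then show ?thesis
    using sup inf True by (auto simp: rat_intervals_def)
qed (auto simp: rat_intervals_def)

section \<open>Differences of convex sets\<close>

lemma convex_set_diffs:
  assumes "convex B" "convex A"
  shows "convex (B \<ominus> A)"
proof -
  have "B \<ominus> A = (\<Union>b\<in>B. \<Union>a\<in>A. {b - a})"
    by (auto simp: set_diffs_def)
  then show ?thesis
    using convex_differences[OF assms] by simp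
qed

text \<open>A frontier point of the difference bounds it on one side. An upper bound must equal
  \<open>Sup B - Inf A\<close>, a lower bound \<open>Inf B - Sup A\<close>, and these extrema are
  frontier points of \<open>B\<close> and \<open>A\<close>.\<close>

lemma frontier_set_diffs_subset:
  assumes "convex B" "convex A"
  shows "frontier (B \<ominus> A) \<subseteq> frontier B \<ominus> frontier A"
proof
  fix x assume "x \<in> frontier (B \<ominus> A)"
  then have cl: "x \<in> closure (B \<ominus> A)"
    and bd: "(\<forall>b\<in>B. \<forall>a\<in>A. b - a \<le> x) \<or> (\<forall>b\<in>B. \<forall>a\<in>A. x \<le> b - a)"
    using convex_set_diffs[OF assms] by (fastforce simp: convex_frontier_real_iff set_diffs_def)+
  have "B \<ominus> A \<noteq> {}"
    using cl by auto
  then obtain a0 b0 where ne: "a0 \<in> A" "b0 \<in> B"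
    by (auto simp: set_diffs_def)
  have approx: "\<exists>b\<in>B. \<exists>a\<in>A. \<bar>b - a - x\<bar> < e" if "e > 0" for e
    using cl that unfolding closure_approachable set_diffs_def dist_real_def by fastforce
  from bd show "x \<in> frontier B \<ominus> frontier A"
  proof
    assume ub: "\<forall>b\<in>B. \<forall>a\<in>A. b - a \<le> x"
    \<comment> \<open>Fixing \<open>a0\<close> in the bound on \<open>b - a\<close> bounds
      \<open>B\<close>, and fixing \<open>b0\<close> bounds \<open>A\<close>. The other ends of
      \<open>B\<close> and \<open>A\<close> may be infinite.\<close>
    have bB: "bdd_above B" and bA: "bdd_below A"
      using ub ne by (force intro!: bdd_aboveI[of _ "x + a0"] bdd_belowI[of _ "b0 - x"])+
    have S: "\<forall>b\<in>B. b \<le> Sup B" "\<forall>a\<in>A. Inf A \<le> a"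
      using bB bA by (auto intro: cSup_upper cInf_lower)
    have fr: "Sup B \<in> frontier B" "Inf A \<in> frontier A"
      using ne S bB bA closure_contains_Sup[of B] closure_contains_Inf[of A]
      by (auto simp: convex_frontier_real_iff assms)
    have "Sup B \<le> x + a" if "a \<in> A" for a
      using ub ne that by (intro cSup_least) force+
    then have "Sup B - x \<le> Inf A"
      using ne by (intro cInf_greatest) force+
    moreover have "x \<le> Sup B - Inf A + e" if "e > 0" for e
      using approx[OF that] S by force
    then have "x \<le> Sup B - Inf A"
      by (rule field_le_epsilon)
    ultimately have "x = Sup B - Inf A"
      by simp
    then show ?thesis
      using fr by (auto simp: set_diffs_def)
  next
    assume lb: "\<forall>b\<in>B. \<forall>a\<in>A. x \<le> b - a"
    have bB: "bdd_below B" and bA: "bdd_above A"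
      using lb ne by (force intro!: bdd_belowI[of _ "x + a0"] bdd_aboveI[of _ "b0 - x"])+
    have S: "\<forall>b\<in>B. Inf B \<le> b" "\<forall>a\<in>A. a \<le> Sup A"
      using bB bA by (auto intro: cSup_upper cInf_lower)
    have fr: "Inf B \<in> frontier B" "Sup A \<in> frontier A"
      using ne S bB bA closure_contains_Inf[of B] closure_contains_Sup[of A]
      by (auto simp: convex_frontier_real_iff assms)
    have "x + a \<le> Inf B" if "a \<in> A" for a
      using lb ne that by (intro cInf_greatest) force+
    then have "Sup A \<le> Inf B - x"
      using ne by (intro cSup_least) force+
    moreover have "Inf B - Sup A \<le> x + e" if "e > 0" for e
      using approx[OF that] S by force
    then have "Inf B - Sup A \<le> x"
      by (rule field_le_epsilon)
    ultimately have "x = Inf B - Sup A"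
      by simp
    then show ?thesis
      using fr by (auto simp: set_diffs_def)
  qed
qed

section \<open>From pieces to the constructed queue\<close>

lemma construct_iq_correct:
  assumes "finite \<Y>" "\<Y> \<subseteq> nonneg_intervals"
  shows "construct_iq \<Y> \<in> interval_queues" "\<Union>(construct_iq \<Y>) = \<Union>\<Y>"
proof -
  obtain Is where Is: "enumerates Is \<Y>"
    using ex_enumerates assms(1) by blast
  then have "set Is = \<Y>" "{} \<notin> set (tl Is)"
    by (simp_all add: enumerates_def)
  then show "construct_iq \<Y> \<in> interval_queues" "\<Union>(construct_iq \<Y>) = \<Union>\<Y>"
    using construct_iq_list_correct[of Is] construct_iq_eq[OF assms(2) Is] assms(2) by auto
qed

text \<open>Each nonempty piece is connected, hence lies inside one queue element; a piece meeting
  \<open>K\<close> must lie in \<open>K\<close> because distinct elements are disjoint. This carries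
  properties of the pieces over to the queue.\<close>

lemma mem_construct_iq_eq_Union:
  assumes Y: "finite \<Y>" "\<Y> \<subseteq> nonneg_intervals" and K: "K \<in> construct_iq \<Y>"
  shows "K = \<Union>{C \<in> \<Y>. C \<noteq> {} \<and> C \<subseteq> K}"
proof
  note Q = construct_iq_correct[OF Y]
  show "K \<subseteq> \<Union>{C \<in> \<Y>. C \<noteq> {} \<and> C \<subseteq> K}"
  proof
    fix x assume x: "x \<in> K"
    then obtain C where C: "C \<in> \<Y>" "x \<in> C"
      using K Q(2) by blast
    then have "connected C" "C \<noteq> {}" "C \<subseteq> \<Union>(construct_iq \<Y>)"
      using Y Q(2) by (auto simp: nonneg_intervals_def)
    then obtain L where L: "L \<in> construct_iq \<Y>" "C \<subseteq> L"
      using connected_subset_interval_queue[OF Q(1)] by metis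
    then have "\<not> disjnt K L"
      using C x by (auto simp: disjnt_def)
    then have "L = K"
      using K L(1) Q(1) separatedin_imp_disjoint
      by (fastforce simp: interval_queues_def pairwise_def)
    then show "x \<in> \<Union>{C \<in> \<Y>. C \<noteq> {} \<and> C \<subseteq> K}"
      using C L by auto
  qed
qed auto

text \<open>The frontier of a finite union lies in the union of the frontiers, so merging pieces
  creates no new endpoints.\<close>

lemma construct_iq_subset_rat_intervals:
  assumes "finite \<Y>" "\<Y> \<subseteq> nonneg_intervals" "\<Y> - {{}} \<subseteq> rat_intervals"
  shows "construct_iq \<Y> \<subseteq> rat_intervals"
proof
  fix K assume K: "K \<in> construct_iq \<Y>"
  let ?C = "{C \<in> \<Y>. C \<noteq> {} \<and> C \<subseteq> K}"
  have "frontier (\<Union>?C) \<subseteq> (\<Union>C\<in>?C. frontier C)"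
    using assms(1) by (intro frontier_Union_subset) simp
  also have "\<dots> \<subseteq> \<rat>"
    using assms(3) by (force simp: rat_intervals_iff_frontier)
  finally have "frontier K \<subseteq> \<rat>"
    using mem_construct_iq_eq_Union[OF assms(1,2) K] by simp
  then show "K \<in> rat_intervals"
    using K construct_iq_correct(1)[OF assms(1,2)]
    by (auto simp: rat_intervals_iff_frontier interval_queues_def)
qed

section \<open>Shape and endpoints of the until pieces\<close>

lemma convex_nonneg_interval: "S \<in> nonneg_intervals \<Longrightarrow> convex S"
  by (auto simp: nonneg_intervals_def is_interval_connected_1[symmetric] is_interval_convex_1)

lemma closure_nonneg_interval: "S \<in> nonneg_intervals \<Longrightarrow> closure S \<in> nonneg_intervals"
  by (simp add: nonneg_intervals_def connected_imp_connected_closure closure_minimal)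

text \<open>Convexity replaces connectedness because it is stable under intersection and \<ominus>.
  The difference may contain negative numbers; the final intersection with \<open>closure H\<close>
  removes them.\<close>

lemma until_piece_in_nonneg_intervals:
  assumes "H \<in> nonneg_intervals" "J \<in> nonneg_intervals" "I \<in> nonneg_intervals"
  shows "((closure H \<inter> J) \<ominus> I) \<inter> closure H \<in> nonneg_intervals"
proof -
  have "convex (((closure H \<inter> J) \<ominus> I) \<inter> closure H)"
    using assms by (intro convex_Int convex_set_diffs convex_nonneg_interval closure_nonneg_interval)
  then show ?thesis
    using closure_nonneg_interval[OF assms(1)]
    by (auto simp: nonneg_intervals_def convex_connected)
qed

lemma until_piece_in_rat_intervals:
  assumes "H \<in> rat_intervals" "J \<in> rat_intervals" "I \<in> rat_intervals"
    and "((closure H \<inter> J) \<ominus> I) \<inter> closure H \<noteq> {}"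
  shows "((closure H \<inter> J) \<ominus> I) \<inter> closure H \<in> rat_intervals"
proof -
  have nn: "H \<in> nonneg_intervals" "J \<in> nonneg_intervals" "I \<in> nonneg_intervals"
    and fr: "frontier H \<subseteq> \<rat>" "frontier J \<subseteq> \<rat>" "frontier I \<subseteq> \<rat>"
    using assms by (auto simp: rat_intervals_iff_frontier)
  \<comment> \<open>Taking the closure can only enlarge the interior, so the frontier does not
    grow.\<close>
  have H: "frontier (closure H) \<subseteq> \<rat>"
    using fr(1) interior_mono[OF closure_subset[of H]] by (auto simp: frontier_def)
  then have HJ: "frontier (closure H \<inter> J) \<subseteq> \<rat>"
    using fr frontier_Int_subset[of "closure H" J] by blast
  have "frontier ((closure H \<inter> J) \<ominus> I) \<subseteq> frontier (closure H \<inter> J) \<ominus> frontier I"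
    using nn
    by (intro frontier_set_diffs_subset convex_Int convex_nonneg_interval closure_nonneg_interval)
  also have "\<dots> \<subseteq> \<rat>"
    using HJ fr(3) by (auto simp: set_diffs_def intro!: Rats_diff)
  finally have "frontier (((closure H \<inter> J) \<ominus> I) \<inter> closure H) \<subseteq> \<rat>"
    using H frontier_Int_subset[of "(closure H \<inter> J) \<ominus> I" "closure H"] by blast
  then show ?thesis
    using assms(4) until_piece_in_nonneg_intervals[OF nn] by (simp add: rat_intervals_iff_frontier)
qed

section \<open>Truth of until and membership in the pieces\<close>

text \<open>Members of \<open>S\<close> closer to \<open>a\<close> and \<open>b\<close> than
  \<open>x\<close> is enclose \<open>x\<close>, and convexity puts \<open>x\<close> into
  \<open>S\<close>.\<close>

lemma greaterThanLessThan_subset_if_closure: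
  fixes S :: "real set"
  assumes "convex S" "a \<in> closure S" "b \<in> closure S"
  shows "{a<..<b} \<subseteq> S"
proof
  fix x assume x: "x \<in> {a<..<b}"
  obtain y where y: "y \<in> S" "dist y a < x - a"
    using assms(2) x unfolding closure_approachable greaterThanLessThan_iff by (metis diff_gt_0_iff_gt)
  obtain z where z: "z \<in> S" "dist z b < b - x"
    using assms(3) x unfolding closure_approachable greaterThanLessThan_iff by (metis diff_gt_0_iff_gt)
  have "y \<le> x" "x \<le> z"
    using y z by (auto simp: dist_real_def)
  then show "x \<in> S"
    using mem_is_interval_1_I[of S y z x] assms(1) y(1) z(1) by (simp add: is_interval_convex_1)
qed

text \<open>A delay \<open>u\<close> in \<open>I\<close> leads from \<open>t\<close> to a point
  \<open>t + u\<close> of some \<open>J\<close>. Both inclusions turn on a single \<open>H\<close>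
  whose closure contains \<open>t\<close> and \<open>t + u\<close>.\<close>

lemma truth_set_Until_eq_Union_until_pieces:
  assumes H: "\<H> \<in> interval_queues" and I: "I \<in> nonneg_intervals"
    and zero: "0 \<in> I \<Longrightarrow> \<Union>\<J> \<subseteq> closure (\<Union>\<H>)"
    and T1: "truth_set z \<phi> = \<Union>\<H>" and T2: "truth_set z \<psi> = \<Union>\<J>"
  shows "truth_set z (Until \<phi> I \<psi>) = \<Union>(until_pieces \<H> I \<J>)"
proof (intro equalityI subsetI)
  fix t assume "t \<in> truth_set z (Until \<phi> I \<psi>)"
  then obtain u where t: "0 \<le> t" and u: "u \<in> I" "sat z (t + u) \<psi>"
    and \<phi>: "\<And>s. s \<in> {0<..<u} \<Longrightarrow> sat z (t + s) \<phi>"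
    by (auto simp: truth_set_def)
  have "0 \<le> u"
    using u I by (auto simp: nonneg_intervals_def)
  then have "t + u \<in> \<Union>\<J>"
    using t u T2 by (auto simp: truth_set_def)
  then obtain J where J': "J \<in> \<J>" "t + u \<in> J"
    by blast
  have "\<exists>H\<in>\<H>. t \<in> closure H \<and> t + u \<in> closure H"
  proof (cases "u = 0")
    \<comment> \<open>With no time strictly between \<open>t\<close> and \<open>t + u\<close>, the
      truth of \<open>\<phi>\<close> supplies no \<open>H\<close>; the assumption
      \<open>zero\<close> does. Finiteness of the queue then places \<open>t\<close> in the closure
      of a single element.\<close>
    case True
    then have "t \<in> closure (\<Union>\<H>)"
      using zero u J' by auto
    also have "closure (\<Union>\<H>) \<subseteq> (\<Union>H\<in>\<H>. closure H)"
    proof (rule closure_minimal)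
      show "\<Union>\<H> \<subseteq> (\<Union>H\<in>\<H>. closure H)"
        using closure_subset by blast
      show "closed (\<Union>H\<in>\<H>. closure H)"
        using H by (intro closed_UN) (auto simp: interval_queues_def)
    qed
    finally show ?thesis
      using True by auto
  next
    case False
    then have tu: "t < t + u"
      using \<open>0 \<le> u\<close> by simp
    have "{t<..<t + u} \<subseteq> \<Union>\<H>"
    proof
      fix x assume "x \<in> {t<..<t + u}"
      then show "x \<in> \<Union>\<H>"
        using \<phi>[of "x - t"] t T1 by (auto simp: truth_set_def)
    qed
    moreover have "connected {t<..<t + u}" "{t<..<t + u} \<noteq> {}"
      using tu by auto
    ultimately obtain K where K: "K \<in> \<H>" "{t<..<t + u} \<subseteq> K"
      using connected_subset_interval_queue[OF H] by metis
    \<comment> \<open>As \<open>t < t + u\<close>, the closure of the open interval includes both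
      endpoints.\<close>
    then have "{t..t + u} \<subseteq> closure K"
      using tu closure_mono[OF K(2)] by simp
    then show ?thesis
      using K(1) tu by (intro bexI[of _ K]) auto
  qed
  then obtain H where H': "H \<in> \<H>" "t \<in> closure H" "t + u \<in> closure H"
    by blast
  then have "t \<in> ((closure H \<inter> J) \<ominus> I) \<inter> closure H"
    using J' u unfolding set_diffs_def by force
  then show "t \<in> \<Union>(until_pieces \<H> I \<J>)"
    using H' J' unfolding until_pieces_def by blast
next
  fix t assume "t \<in> \<Union>(until_pieces \<H> I \<J>)"
  then obtain H J b u where HJ: "H \<in> \<H>" "J \<in> \<J>" "b \<in> closure H" "b \<in> J" "u \<in> I"
    and t: "t \<in> closure H" "t = b - u"
    by (auto simp: until_pieces_def set_diffs_def)
  have Hn: "H \<in> nonneg_intervals"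
    using H HJ by (auto simp: interval_queues_def)
  have "0 \<le> t"
    using closure_nonneg_interval[OF Hn] t by (auto simp: nonneg_intervals_def)
  \<comment> \<open>Only the endpoints need the closure of \<open>H\<close>; strictly between them
    every time belongs to \<open>H\<close> itself.\<close>
  have sub: "{t<..<b} \<subseteq> truth_set z \<phi>"
    using greaterThanLessThan_subset_if_closure[OF convex_nonneg_interval[OF Hn] t(1) HJ(3)]
      HJ(1) T1 by blast
  have "sat z (t + s) \<phi>" if "s \<in> {0<..<u}" for s
    using subsetD[OF sub, of "t + s"] that t(2) by (auto simp: truth_set_def)
  moreover have "b \<in> truth_set z \<psi>"
    using HJ T2 by blast
  then have "sat z (t + u) \<psi>"
    using t(2) by (auto simp: truth_set_def)
  ultimately show "t \<in> truth_set z (Until \<phi> I \<psi>)"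
    using HJ(5) \<open>0 \<le> t\<close> by (auto simp: truth_set_def)
qed

theorem corollary1:
  fixes \<H> \<J> :: "real set set" and G :: "'g set" and I :: "real set"
    and \<phi>\<^sub>1 \<phi>\<^sub>2 :: "'g mitl" and z :: "real \<Rightarrow> 'g set"
  assumes "\<H> \<in> interval_queues" and "\<J> \<in> interval_queues"
    and "finite G"
    and "I \<in> rat_intervals" and "nondegenerate I"
    and "\<phi>\<^sub>1 \<in> mitl_formulas G" and "\<phi>\<^sub>2 \<in> mitl_formulas G"
    and "signal G z" and "finite_variability z"
    and "truth_set z \<phi>\<^sub>1 \<supseteq> \<Union>\<H>" and "truth_set z \<phi>\<^sub>2 \<supseteq> \<Union>\<J>"
  shows "until_iq \<H> I \<J> \<in> interval_queues \<and>
    ((0 \<in> I \<longrightarrow> \<Union>\<J> \<subseteq> closure (\<Union>\<H>)) \<longrightarrow>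
       truth_set z \<phi>\<^sub>1 = \<Union>\<H> \<and> truth_set z \<phi>\<^sub>2 = \<Union>\<J> \<longrightarrow>
       truth_set z (Until \<phi>\<^sub>1 I \<phi>\<^sub>2) = \<Union>(until_iq \<H> I \<J>)) \<and>
    (\<H> \<subseteq> rat_intervals \<and> \<J> \<subseteq> rat_intervals \<longrightarrow> until_iq \<H> I \<J> \<subseteq> rat_intervals)"
proof -
  have sub: "\<H> \<subseteq> nonneg_intervals" "\<J> \<subseteq> nonneg_intervals" "I \<in> nonneg_intervals"
    and fin: "finite \<H>" "finite \<J>"
    using assms(1,2,4) by (auto simp: interval_queues_def rat_intervals_def)
  have "((closure H \<inter> J) \<ominus> I) \<inter> closure H \<in> nonneg_intervals" if "H \<in> \<H>" "J \<in> \<J>" for H J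
    using that sub by (intro until_piece_in_nonneg_intervals) auto
  then have Y: "finite (until_pieces \<H> I \<J>)" "until_pieces \<H> I \<J> \<subseteq> nonneg_intervals"
    using fin by (auto simp: until_pieces_def finite_image_set2)
  have "until_iq \<H> I \<J> \<subseteq> rat_intervals" if "\<H> \<subseteq> rat_intervals" "\<J> \<subseteq> rat_intervals"
    unfolding until_iq_def
  proof (rule construct_iq_subset_rat_intervals[OF Y])
    \<comment> \<open>Some pieces may be empty, for instance when \<open>closure H\<close> misses
      \<open>J\<close>; only the others need rational endpoints.\<close>
    show "until_pieces \<H> I \<J> - {{}} \<subseteq> rat_intervals"
      using that assms(4) until_piece_in_rat_intervals unfolding until_pieces_def by blast
  qed
  then show ?thesis
    using construct_iq_correct[OF Y]
      truth_set_Until_eq_Union_until_pieces[OF assms(1) sub(3), of \<J> z \<phi>\<^sub>1 \<phi>\<^sub>2]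
    by (auto simp: until_iq_def)
qed

end
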